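(* Let $r\in\mathbb{N}$, let $a_1\in\mathbb{N}$ and $a_2,\dots,a_r\in\mathbb{N}_0$, and put $\mathbf{s}=(\{2\}^{a_1},1,\{2\}^{a_2},1,\dots,\{2\}^{a_r},1)$. Then \[ \zeta^\star(\mathbf{s})=\sum_{\mathbf{p}} 2^{\ell(\mathbf{p})}\zeta(\mathbf{p}), \] where $\mathbf{p}$ runs through all $2^{r-1}$ indices of the form $(2a_1+1)\circ(2a_2+1)\circ\cdots\circ(2a_r+1)$, each symbol $\circ$ being independently either the comma "," or the plus sign "$+$" (so that consecutive entries joined by $+$ are added into a single component).
   Context: $\mathbb{N}=\{1,2,\dots\}$, $\mathbb{N}_0=\mathbb{N}\cup\{0\}$. For a composition $\mathbf{s}=(s_1,\dots,s_\ell)$ of positive integers, $H_n(\mathbf{s})=\sum_{n\ge k_1>k_2>\cdots>k_\ell\ge1}\prod_{i=1}^\ell k_i^{-s_i}$ and $H^\star_n(\mathbf{s})=\sum_{n\ge k_1\ge k_2\ge\cdots\ge k_\ell\ge1}\prod_{i=1}^\ell k_i^{-s_i}$; when $s_1\ge2$, the multiple zeta value is $\zeta(\mathbf{s})=\lim_{n\to\infty}H_n(\mathbf{s})$ and the multiple zeta star value is $\zeta^\star(\mathbf{s})=\lim_{n\to\infty}H^\star_n(\mathbf{s})$. $\ell(\mathbf{p})$ denotes the number of components (depth) of $\mathbf{p}$. $\{2\}^a$ denotes the string $2,2,\dots,2$ ($a$ copies; empty if $a=0$). *)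

theory Defs
  imports "HOL-Analysis.Analysis"
begin

text \<open>
  Compositions are lists of positive naturals. The list \<open>ks\<close> holds the summation indices in the
  order \<open>k\<^sub>1, \<dots>, k\<^sub>\<ell>\<close>, so it is strictly (resp. weakly) decreasing.
\<close>

definition mhs :: "nat list \<Rightarrow> nat \<Rightarrow> real" where
  "mhs s n = (\<Sum>ks | length ks = length s \<and> set ks \<subseteq> {1..n} \<and> sorted_wrt (>) ks.
                \<Prod>i<length s. 1 / real (ks ! i) ^ (s ! i))"

definition mhs_star :: "nat list \<Rightarrow> nat \<Rightarrow> real" where
  "mhs_star s n = (\<Sum>ks | length ks = length s \<and> set ks \<subseteq> {1..n} \<and> sorted_wrt (\<ge>) ks.
                \<Prod>i<length s. 1 / real (ks ! i) ^ (s ! i))"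

text \<open>
  Since \<open>lim\<close> is total, the next two constants carry meaning only for compositions whose first
  entry is at least 2, where the limits exist.
\<close>

definition mzv :: "nat list \<Rightarrow> real" where
  "mzv s = lim (mhs s)"

definition mzsv :: "nat list \<Rightarrow> real" where
  "mzsv s = lim (mhs_star s)"

datatype sep = Comma | Plus

text \<open>
  \<open>join_seps [x\<^sub>1, \<dots>, x\<^sub>r] [c\<^sub>1, \<dots>, c\<^sub>r\<^sub>-\<^sub>1]\<close> is the index \<open>x\<^sub>1 c\<^sub>1 x\<^sub>2 c\<^sub>2 \<dots> c\<^sub>r\<^sub>-\<^sub>1 x\<^sub>r\<close>.
  The remaining equation only covers lists of other lengths and the end of the recursion.
\<close>

fun join_seps :: "nat list \<Rightarrow> sep list \<Rightarrow> nat list" where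
  "join_seps (x # y # xs) (Comma # cs) = x # join_seps (y # xs) cs"
| "join_seps (x # y # xs) (Plus # cs) = join_seps ((x + y) # xs) cs"
| "join_seps xs cs = xs"

end

theory Submission
  imports Defs "HOL-Real_Asymp.Real_Asymp"
begin

text \<open>
  Write \<open>c(n,k) = (n choose k) / (n + k choose k)\<close>. The star sums of \<open>\<^bold>s\<close> have the finite form
  \<open>H\<^sup>\<star>\<^sub>n(\<^bold>s) = (\<Sum>k\<le>n. c(n,k) g(k))\<close>. Prepending \<open>2\<close> divides \<open>g(k)\<close> by \<open>k\<^sup>2\<close>, because
  \<open>c(n,k) - c(n-1,k) = c(n,k) k\<^sup>2 / n\<^sup>2\<close>; prepending \<open>1\<close> replaces \<open>g(k)\<close> by
  \<open>(g(k) + 2 (\<Sum>j<k. g(j))) / k\<close>, whose two terms are the choices ``plus'' and ``comma''. Since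
  \<open>0 \<le> c(n,k) \<le> 1\<close> and \<open>c(n,k) \<longrightarrow> 1\<close> as \<open>n \<longrightarrow> \<infinity>\<close>, Tannery's theorem gives the limit.
\<close>

section \<open>Recursion of harmonic sums in the first entry\<close>

text \<open>Splitting off the largest index treats both orders at once: \<open>b k\<close> is
  \<open>k - 1\<close> for strict and \<open>k\<close> for weak decrease. Restricting to
  \<open>1 \<le> j\<close> matters for truncated subtraction at \<open>k = 0\<close>.\<close>

lemma decreasing_lists_Suc:
  fixes b :: "nat \<Rightarrow> nat" and R :: "nat \<Rightarrow> nat \<Rightarrow> bool"
  assumes "\<And>k j. 1 \<le> j \<Longrightarrow> R k j \<longleftrightarrow> j \<le> b k" and "\<And>k. b k \<le> k"
  shows "bij_betw (\<lambda>(k, ks). k # ks)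
    (SIGMA k:{1..n}. {ks. length ks = l \<and> set ks \<subseteq> {1..b k} \<and> sorted_wrt R ks})
    {ks. length ks = Suc l \<and> set ks \<subseteq> {1..n} \<and> sorted_wrt R ks}"
proof (rule bij_betw_imageI)
  show "(\<lambda>(k, ks). k # ks) `
      (SIGMA k:{1..n}. {ks. length ks = l \<and> set ks \<subseteq> {1..b k} \<and> sorted_wrt R ks}) =
      {ks. length ks = Suc l \<and> set ks \<subseteq> {1..n} \<and> sorted_wrt R ks}" (is "?f ` ?A = ?B")
  proof
    show "?f ` ?A \<subseteq> ?B"
    proof
      fix js assume "js \<in> ?f ` ?A"
      then obtain k ks where js: "js = k # ks" "k \<in> {1..n}" "set ks \<subseteq> {1..b k}"
        "length ks = l" "sorted_wrt R ks" by auto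
      have "b k \<le> n" using assms(2)[of k] js(2) by simp
      then have "set ks \<subseteq> {1..n}" using js(3) by auto
      moreover have "\<forall>j\<in>set ks. R k j" using js(3) assms(1) by auto
      ultimately show "js \<in> ?B" using js by simp
    qed
    show "?B \<subseteq> ?f ` ?A"
    proof
      fix ks assume ks: "ks \<in> ?B"
      then obtain k js where "ks = k # js" by (cases ks) auto
      with ks have js: "set js \<subseteq> {1..n}" "\<forall>j\<in>set js. R k j" by auto
      then have "set js \<subseteq> {1..b k}" using assms(1) by fastforce
      with ks \<open>ks = k # js\<close> have "(k, js) \<in> ?A" "ks = ?f (k, js)" by auto
      then show "ks \<in> ?f ` ?A" by blast
    qed
  qed
qed (auto intro: inj_onI)

lemma finite_bounded_lists:
  "finite {ks. length ks = l \<and> set ks \<subseteq> {1..n::nat} \<and> P ks}"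
  by (rule finite_subset[OF _ finite_lists_length_eq[of "{1..n}" l]]) auto

lemma sum_decreasing_lists_Cons:
  fixes b :: "nat \<Rightarrow> nat" and R :: "nat \<Rightarrow> nat \<Rightarrow> bool"
  assumes "\<And>k j. 1 \<le> j \<Longrightarrow> R k j \<longleftrightarrow> j \<le> b k" and "\<And>k. b k \<le> k"
  shows "(\<Sum>ks | length ks = length (x # s) \<and> set ks \<subseteq> {1..n} \<and> sorted_wrt R ks.
      \<Prod>i<length (x # s). 1 / real (ks ! i) ^ ((x # s) ! i)) =
    (\<Sum>k=1..n. (\<Sum>ks | length ks = length s \<and> set ks \<subseteq> {1..b k} \<and> sorted_wrt R ks.
      \<Prod>i<length s. 1 / real (ks ! i) ^ (s ! i)) / real k ^ x)"
proof -
  let ?w = "\<lambda>s ks. \<Prod>i<length s. 1 / real (ks ! i) ^ (s ! i)"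
  let ?A = "\<lambda>k. {ks. length ks = length s \<and> set ks \<subseteq> {1..b k} \<and> sorted_wrt R ks}"
  have bij: "bij_betw (\<lambda>(k, ks). k # ks) (SIGMA k:{1..n}. ?A k)
      {ks. length ks = Suc (length s) \<and> set ks \<subseteq> {1..n} \<and> sorted_wrt R ks}"
    by (rule decreasing_lists_Suc) (fact assms)+
  have "(\<Sum>ks | length ks = length (x # s) \<and> set ks \<subseteq> {1..n} \<and> sorted_wrt R ks. ?w (x # s) ks) =
      (\<Sum>(k, ks)\<in>(SIGMA k:{1..n}. ?A k). ?w (x # s) (k # ks))"
    unfolding length_Cons
    by (subst sum.reindex_bij_betw[OF bij, symmetric]) (simp add: split_beta)
  also have "\<dots> = (\<Sum>k=1..n. \<Sum>ks\<in>?A k. ?w (x # s) (k # ks))"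
    by (rule sum.Sigma[symmetric]) (intro finite_atLeastAtMost ballI finite_bounded_lists)+
  also have "\<dots> = (\<Sum>k=1..n. (\<Sum>ks\<in>?A k. ?w s ks) / real k ^ x)"
    by (simp add: prod.lessThan_Suc_shift sum_divide_distrib del: prod.lessThan_Suc)
  finally show ?thesis .
qed

lemma mhs_Nil [simp]: "mhs [] n = 1"
  and mhs_star_Nil [simp]: "mhs_star [] n = 1"
proof -
  have "{ks. length ks = 0 \<and> set ks \<subseteq> {1..n} \<and> sorted_wrt R ks} = {[]}" for R by auto
  then show "mhs [] n = 1" "mhs_star [] n = 1"
    by (simp_all add: mhs_def mhs_star_def)
qed

lemma mhs_Cons: "mhs (x # s) n = (\<Sum>k=1..n. mhs s (k - 1) / real k ^ x)"
  unfolding mhs_def by (rule sum_decreasing_lists_Cons) auto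

lemma mhs_star_Cons: "mhs_star (x # s) n = (\<Sum>k=1..n. mhs_star s k / real k ^ x)"
  unfolding mhs_star_def by (rule sum_decreasing_lists_Cons) auto

lemma mhs_nonneg: "0 \<le> mhs s n"
  unfolding mhs_def by (intro sum_nonneg prod_nonneg) auto

text \<open>A crude linear bound, each summand being at most 1 by induction. It suffices for
  convergence when the first entry is at least 3.\<close>

lemma mhs_le: "0 \<notin> set s \<Longrightarrow> mhs s n \<le> real n + 1"
proof (induction s arbitrary: n)
  case (Cons x s)
  have "mhs s (k - 1) / real k ^ x \<le> 1" if "k \<in> {1..n}" for k
  proof -
    have "mhs s (k - 1) \<le> real k" using Cons.IH[of "k - 1"] Cons.prems that by (simp add: of_nat_diff)
    also have "\<dots> \<le> real k ^ x" using that Cons.prems by (intro self_le_power) auto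
    finally show ?thesis using that by simp
  qed
  from sum_mono[OF this] have "mhs (x # s) n \<le> (\<Sum>k=1..n. 1)"
    unfolding mhs_Cons .
  then show ?case by simp
qed simp

section \<open>The factor \<open>c(n,k)\<close> and sums weighted by it\<close>

\<comment> \<open>The factor \<open>c(n,k)\<close> of the introduction, as a product.\<close>
definition mollifier :: "nat \<Rightarrow> nat \<Rightarrow> real" where
  "mollifier n k = (\<Prod>i<k. (real n - real i) / (real n + real i + 1))"

lemma mollifier_0 [simp]: "mollifier n 0 = 1"
  by (simp add: mollifier_def)

lemma mollifier_Suc:
  "mollifier n (Suc k) = mollifier n k * ((real n - real k) / (real n + real k + 1))"
  by (simp add: mollifier_def)

lemma mollifier_eq_0: "n < k \<Longrightarrow> mollifier n k = 0"
  by (auto simp: mollifier_def)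

lemma mollifier_bounds: "0 \<le> mollifier n k \<and> mollifier n k \<le> 1"
proof (cases "k \<le> n")
  case True
  then show ?thesis unfolding mollifier_def by (auto intro!: prod_nonneg prod_le_1)
qed (simp add: mollifier_eq_0)

lemma mollifier_tendsto: "(\<lambda>n. mollifier n k) \<longlonglongrightarrow> 1"
proof -
  have "(\<lambda>n. (real n - real i) / (real n + real i + 1)) \<longlonglongrightarrow> 1" for i by real_asymp
  then have "(\<lambda>n. mollifier n k) \<longlonglongrightarrow> (\<Prod>i<k. 1)"
    unfolding mollifier_def by (intro tendsto_prod)
  then show ?thesis by simp
qed

lemma mollifier_diff:
  "(mollifier (Suc n) k - mollifier n k) * real (Suc n) ^ 2 = mollifier (Suc n) k * real k ^ 2"
proof (induction k)
  case (Suc k)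
  define c d where "c = mollifier n k" and "d = mollifier (Suc n) k"
  \<comment> \<open>The difference of squares is factored so that \<open>n + 1 + k\<close> cancels
    the denominator of the new factor of \<open>c(n,k+1)\<close>.\<close>
  have IH: "c * (real n + 1) ^ 2 = d * ((real n + 1) - real k) * (real n + 1 + real k)"
    using Suc unfolding c_def d_def by (simp add: power2_eq_square algebra_simps)
  have "c * ((real n - real k) / (real n + real k + 1)) * (real n + 1) ^ 2 =
      c * (real n + 1) ^ 2 * ((real n - real k) / (real n + real k + 1))" by simp
  also have "\<dots> = d * (real n + 1 - real k) * (real n - real k)"
    unfolding IH by (simp add: field_simps)
  also have "\<dots> = d * ((real n + 1 - real k) / (real n + 1 + real k + 1)) *
      ((real n + 1) ^ 2 - (real k + 1) ^ 2)"
    by (simp add: field_simps) (simp add: power2_eq_square algebra_simps)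
  finally have "mollifier n (Suc k) * (real n + 1) ^ 2 =
      mollifier (Suc n) (Suc k) * ((real n + 1) ^ 2 - (real k + 1) ^ 2)"
    by (simp add: mollifier_Suc c_def d_def add_ac)
  then show ?case by (simp add: algebra_simps)
qed simp

definition mollified :: "(nat \<Rightarrow> real) \<Rightarrow> nat \<Rightarrow> real" where
  "mollified g n = (\<Sum>k\<le>n. mollifier n k * g k)"

lemma mollified_Suc_diff:
  "mollified g (Suc n) - mollified g n =
    (\<Sum>k\<le>Suc n. mollifier (Suc n) k * real k ^ 2 * g k) / real (Suc n) ^ 2"
proof -
  \<comment> \<open>The added term vanishes because \<open>c(n,n+1) = 0\<close>; both sums now have
    the same range.\<close>
  have "mollified g n = (\<Sum>k\<le>Suc n. mollifier n k * g k)"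
    by (simp add: mollified_def mollifier_eq_0)
  then have "mollified g (Suc n) - mollified g n =
      (\<Sum>k\<le>Suc n. (mollifier (Suc n) k - mollifier n k) * g k)"
    by (simp add: mollified_def sum_subtractf[symmetric] algebra_simps del: sum.atMost_Suc)
  also have "\<dots> = (\<Sum>k\<le>Suc n. mollifier (Suc n) k * real k ^ 2 * g k / real (Suc n) ^ 2)"
  proof (rule sum.cong)
    fix k
    have "mollifier (Suc n) k - mollifier n k = mollifier (Suc n) k * real k ^ 2 / real (Suc n) ^ 2"
      using mollifier_diff[of n k] by (simp add: eq_divide_eq)
    then show "(mollifier (Suc n) k - mollifier n k) * g k =
        mollifier (Suc n) k * real k ^ 2 * g k / real (Suc n) ^ 2" by simp
  qed simp
  finally show ?thesis by (simp only: sum_divide_distrib)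
qed

text \<open>The right side telescopes in \<open>n\<close>. Multiplying \<open>g k / k^2\<close> by
  \<open>k^2\<close> restores \<open>g k\<close> except at \<open>k = 0\<close>, where it gives 0;
  hence the assumption on \<open>g 0\<close>.\<close>

lemma sum_mollified_square:
  assumes "g 0 = 0"
  shows "(\<Sum>m=1..n. mollified g m / real m ^ 2) = mollified (\<lambda>k. g k / real k ^ 2) n"
proof (induction n)
  case (Suc n)
  have "mollified (\<lambda>k. g k / real k ^ 2) (Suc n) - mollified (\<lambda>k. g k / real k ^ 2) n =
      mollified g (Suc n) / real (Suc n) ^ 2"
    unfolding mollified_Suc_diff unfolding mollified_def
    by (intro arg_cong2[where f = "(/)"] sum.cong refl) (use assms in auto)
  with Suc show ?case by simp
qed (simp add: mollified_def)

\<comment> \<open>Summation by parts, using \<open>(n - N) c(n,N) = (n + N + 1) c(n,N+1)\<close> for the mollifier \<open>c\<close>.\<close>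
lemma mollifier_by_parts:
  "(\<Sum>k\<le>N. mollifier n k * real k * (g k + 2 * (\<Sum>j<k. g j))) =
    real n * (\<Sum>k\<le>N. mollifier n k * g k) - (real n - real N) * mollifier n N * (\<Sum>k\<le>N. g k)"
proof (induction N)
  case (Suc N)
  define G where "G = (\<Sum>k\<le>N. g k)"
  have "(real n - real N) * mollifier n N = (real n + real N + 1) * mollifier n (Suc N)"
    by (simp add: mollifier_Suc)
  then have "(real n - real N) * mollifier n N * G = (real n + real N + 1) * mollifier n (Suc N) * G"
    by simp
  with Suc show ?case
    by (simp add: lessThan_Suc_atMost G_def[symmetric] algebra_simps)
qed simp

lemma sum_mollified_inverse:
  "(\<Sum>m=1..n. mollified g m / real m) = mollified (\<lambda>k. (g k + 2 * (\<Sum>j<k. g j)) / real k) n"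
    (is "_ = mollified ?h n")
proof (induction n)
  case (Suc n)
  have "mollified ?h (Suc n) - mollified ?h n =
      (\<Sum>k\<le>Suc n. mollifier (Suc n) k * real k * (g k + 2 * (\<Sum>j<k. g j))) / real (Suc n) ^ 2"
    unfolding mollified_Suc_diff
    by (intro arg_cong2[where f = "(/)"] sum.cong refl) (auto simp: power2_eq_square)
  \<comment> \<open>Summation by parts up to \<open>N = Suc n\<close>, with upper parameter also
    \<open>Suc n\<close>, so the boundary factor is 0.\<close>
  also have "\<dots> = real (Suc n) * mollified g (Suc n) / real (Suc n) ^ 2"
    unfolding mollifier_by_parts by (simp add: mollified_def)
  also have "\<dots> = mollified g (Suc n) / real (Suc n)"
    by (simp add: power2_eq_square)
  finally show ?case using Suc by simp
qed (simp add: mollified_def)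

section \<open>Star sums as weighted sums\<close>

text \<open>The function \<open>g\<close> of the introduction, one block of twos and a one per
  entry. It starts from the indicator of 0 because \<open>c(n,0) = 1\<close> then reproduces the
  empty star sum 1.\<close>

fun two_one_weight :: "nat list \<Rightarrow> nat \<Rightarrow> real" where
  "two_one_weight [] k = (if k = 0 then 1 else 0)"
| "two_one_weight (x # xs) k =
    (two_one_weight xs k + 2 * (\<Sum>j<k. two_one_weight xs j)) / real k ^ x"

lemma mhs_star_block:
  assumes "mhs_star s = mollified g"
  shows "mhs_star (replicate a 2 @ 1 # s) =
    mollified (\<lambda>k. (g k + 2 * (\<Sum>j<k. g j)) / real k ^ (2 * a + 1))"
proof (induction a)
  case 0
  show ?case using sum_mollified_inverse by (auto simp: mhs_star_Cons assms)
next
  case (Suc a)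
  show ?case
  proof
    fix n
    have "mhs_star (replicate (Suc a) 2 @ 1 # s) n =
        mollified (\<lambda>k. (g k + 2 * (\<Sum>j<k. g j)) / real k ^ (2 * a + 1) / real k ^ 2) n"
      \<comment> \<open>The condition at \<open>k = 0\<close> holds because division by
        \<open>0 ^ (2 * a + 1) = 0\<close> yields 0.\<close>
      by (simp only: replicate_Suc append_Cons mhs_star_Cons Suc)
        (rule sum_mollified_square, simp)
    also have "\<dots> = mollified (\<lambda>k. (g k + 2 * (\<Sum>j<k. g j)) / real k ^ (2 * Suc a + 1)) n"
      by (simp add: power2_eq_square mult_ac)
    finally show "mhs_star (replicate (Suc a) 2 @ 1 # s) n = \<dots>" .
  qed
qed

lemma mhs_star_two_one:
  "mhs_star (concat (map (\<lambda>a. replicate a 2 @ [1]) as)) =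
    mollified (two_one_weight (map (\<lambda>a. 2 * a + 1) as))"
proof (induction as)
  case Nil
  show ?case
  proof
    fix n
    have "mollified (two_one_weight []) n = (\<Sum>k\<le>n. if k = 0 then 1 else 0)"
      unfolding mollified_def by (rule sum.cong) auto
    then show "mhs_star (concat (map (\<lambda>a. replicate a 2 @ [1]) [])) n =
        mollified (two_one_weight (map (\<lambda>a. 2 * a + 1) [])) n" by simp
  qed
next
  case (Cons a as)
  from mhs_star_block[OF this, of a] show ?case by simp
qed

section \<open>Expansion of the weights over separators\<close>

text \<open>The part of the harmonic sum of \<open>p\<close> whose largest index is
  \<open>k\<close>. At \<open>k = 0\<close> it is 0 if the first entry is positive, so sums may
  start at 0.\<close>

definition mhs_term :: "nat list \<Rightarrow> nat \<Rightarrow> real" where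
  "mhs_term p k = mhs (tl p) (k - 1) / real k ^ hd p"

lemma mhs_eq_sum_mhs_term:
  assumes "p \<noteq> []" "0 \<notin> set p"
  shows "mhs p n = (\<Sum>k<Suc n. mhs_term p k)"
proof -
  obtain x q where p: "p = x # q" "0 < x" using assms by (cases p) auto
  show ?thesis
    by (simp add: p mhs_Cons mhs_term_def sum.atLeast1_atMost_eq sum.lessThan_Suc_shift
        del: sum.lessThan_Suc)
qed

text \<open>Adding \<open>x\<close> to the first entry commutes with joining, so a leading
  \<open>Plus\<close> just divides the corresponding \<open>mhs_term\<close> by
  \<open>k ^ x\<close>.\<close>

lemma join_seps_add:
  "join_seps ((x + y) # xs) cs =
    (x + hd (join_seps (y # xs) cs)) # tl (join_seps (y # xs) cs)"
proof (induction "y # xs" cs arbitrary: y xs rule: join_seps.induct)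
  case (2 y z xs cs)
  then show ?case using 2 by (simp add: add.assoc)
qed auto

lemma join_seps_Nil_iff [simp]: "join_seps xs cs = [] \<longleftrightarrow> xs = []"
  by (induction xs cs rule: join_seps.induct) auto

lemma join_seps_pos: "0 \<notin> set xs \<Longrightarrow> 0 \<notin> set (join_seps xs cs)"
  by (induction xs cs rule: join_seps.induct) auto

lemma hd_join_seps: "hd xs \<le> hd (join_seps xs cs)"
  by (induction xs cs rule: join_seps.induct) auto

lemma UNIV_sep: "(UNIV :: sep set) = {Comma, Plus}"
  by (auto intro: sep.exhaust)

lemma finite_sep_lists [simp]: "finite {cs :: sep list. length cs = n}"
proof -
  have "finite (UNIV :: sep set)" by (simp add: UNIV_sep)
  from finite_lists_length_eq[OF this, of n] show ?thesis by simp
qed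

lemma sum_sep_lists_Suc:
  fixes f :: "sep list \<Rightarrow> 'a :: comm_monoid_add"
  shows "(\<Sum>cs | length cs = Suc n. f cs) =
    (\<Sum>cs | length cs = n. f (Comma # cs)) + (\<Sum>cs | length cs = n. f (Plus # cs))"
proof -
  have eq: "{cs. length cs = Suc n} =
      (#) Comma ` {cs. length cs = n} \<union> (#) Plus ` {cs. length cs = n}"
  proof (intro set_eqI iffI)
    fix cs :: "sep list" assume "cs \<in> {cs. length cs = Suc n}"
    then obtain c ds where "cs = c # ds" "length ds = n" by (cases cs) auto
    then show "cs \<in> (#) Comma ` {cs. length cs = n} \<union> (#) Plus ` {cs. length cs = n}"
      by (cases c) auto
  qed auto
  show ?thesis unfolding eq
    by (subst sum.union_disjoint) (auto simp: sum.reindex)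
qed

text \<open>In the recursion for the weight, the undoubled term matches \<open>Plus\<close>. The
  doubled sum over \<open>j < k\<close> matches \<open>Comma\<close>: a new largest index
  \<open>k\<close> above \<open>j\<close>, with the factor 2 paying for the extra component.\<close>

lemma two_one_weight_eq_sum:
  assumes "xs \<noteq> []" "0 \<notin> set xs"
  shows "two_one_weight xs k =
    (\<Sum>cs | length cs = length xs - 1. 2 ^ length (join_seps xs cs) * mhs_term (join_seps xs cs) k)"
  using assms
proof (induction xs arbitrary: k rule: induct_list012)
  \<comment> \<open>For \<open>k > 0\<close> the indicator of 0 sums to 1 over \<open>j < k\<close>,
    giving \<open>2 / k ^ x\<close>; at \<open>k = 0\<close> both sides are 0 since
    \<open>x > 0\<close>.\<close>
  case (2 x)
  have "(\<Sum>j<k. if j = 0 then 1 else 0) = (if k = 0 then 0 else 1 :: real)" by auto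
  with 2 show ?case by (cases k) (auto simp: mhs_term_def)
next
  case (3 x y xs)
  let ?q = "join_seps (y # xs)" and ?S = "{cs :: sep list. length cs = length xs}"
  have IH: "two_one_weight (y # xs) j = (\<Sum>cs\<in>?S. 2 ^ length (?q cs) * mhs_term (?q cs) j)" for j
    using 3 by simp
  have pos: "x > 0" "0 \<notin> set (y # xs)" using 3 by auto
  have comma: "mhs_term (x # ?q cs) k = (\<Sum>j<k. mhs_term (?q cs) j) / real k ^ x" for cs
  proof (cases k)
    case 0
    with pos show ?thesis by (simp add: mhs_term_def)
  next
    case (Suc m)
    then show ?thesis
      using mhs_eq_sum_mhs_term[OF _ join_seps_pos[OF pos(2)], of cs m] by (simp add: mhs_term_def)
  qed
  have plus: "mhs_term (join_seps ((x + y) # xs) cs) k = mhs_term (?q cs) k / real k ^ x"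
    "length (join_seps ((x + y) # xs) cs) = length (?q cs)" for cs
    by (simp_all add: join_seps_add mhs_term_def power_add mult_ac)
  have "two_one_weight (x # y # xs) k =
      ((\<Sum>cs\<in>?S. 2 ^ length (?q cs) * mhs_term (?q cs) k) +
       2 * (\<Sum>cs\<in>?S. 2 ^ length (?q cs) * (\<Sum>j<k. mhs_term (?q cs) j))) / real k ^ x"
    by (subst two_one_weight.simps(2), unfold IH, subst sum.swap)
      (simp add: sum_distrib_left)
  also have "\<dots> = (\<Sum>cs\<in>?S. 2 ^ length (?q cs) * (mhs_term (?q cs) k / real k ^ x)) +
      (\<Sum>cs\<in>?S. 2 * 2 ^ length (?q cs) * ((\<Sum>j<k. mhs_term (?q cs) j) / real k ^ x))"
    by (simp add: sum_divide_distrib sum_distrib_left add_divide_distrib mult.assoc)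
  finally show ?case
    by (simp add: sum_sep_lists_Suc comma plus add.commute)
qed simp

section \<open>Passage to the limit\<close>

lemma mhs_term_nonneg: "0 \<le> mhs_term p k"
  by (simp add: mhs_term_def mhs_nonneg)

text \<open>The linear bound on the inner sum costs one power of \<open>k\<close>, so a first entry
  of at least 3 leaves a comparison with \<open>1 / k^2\<close>.\<close>

lemma mhs_term_summable:
  assumes "p \<noteq> []" "0 \<notin> set p" "hd p \<ge> 3"
  shows "summable (mhs_term p)"
proof (rule summable_comparison_test)
  have "norm (mhs_term p k) \<le> inverse (real k ^ 2)" for k
  proof (cases k)
    case 0
    with assms show ?thesis by (simp add: mhs_term_def power_0_left)
  next
    case (Suc m)
    have "0 \<notin> set (tl p)" using assms by (cases p) auto
    from mhs_le[OF this, of m] have "mhs (tl p) m \<le> real k" using Suc by simp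
    then have "mhs_term p k \<le> real k / real k ^ hd p"
      using Suc by (simp add: mhs_term_def divide_right_mono)
    also have "\<dots> \<le> real k / real k ^ 3"
      using Suc assms by (intro divide_left_mono power_increasing) auto
    also have "\<dots> = inverse (real k ^ 2)"
      using Suc by (simp add: divide_inverse power2_eq_square power3_eq_cube del: of_nat_Suc)
    finally show ?thesis using mhs_term_nonneg[of p k] by simp
  qed
  then show "\<exists>N. \<forall>n\<ge>N. norm (mhs_term p n) \<le> inverse (real n ^ 2)" by blast
qed (rule inverse_power_summable, simp)

lemma mzv_eq_suminf:
  assumes "p \<noteq> []" "0 \<notin> set p" "hd p \<ge> 3"
  shows "mzv p = suminf (mhs_term p)"
proof -
  have "mhs p = (\<lambda>n. \<Sum>k<Suc n. mhs_term p k)"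
    using mhs_eq_sum_mhs_term assms by blast
  then have "mhs p \<longlonglongrightarrow> suminf (mhs_term p)"
    using LIMSEQ_Suc[OF summable_LIMSEQ[OF mhs_term_summable[OF assms]]] by simp
  then show ?thesis by (simp add: mzv_def limI)
qed

lemma mollified_tendsto:
  assumes "summable g" "\<And>k. 0 \<le> g k"
  shows "mollified g \<longlonglongrightarrow> suminf g"
proof -
  \<comment> \<open>Since \<open>c(n,k) = 0\<close> for \<open>k > n\<close>, the sum is a full
    series, dominated by \<open>g\<close> itself.\<close>
  have "mollified g n = (\<Sum>k. mollifier n k * g k)" for n
    unfolding mollified_def by (rule suminf_finite[symmetric]) (auto simp: mollifier_eq_0)
  moreover have "(\<lambda>n. \<Sum>k. mollifier n k * g k) \<longlonglongrightarrow> suminf g"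
  proof (rule tannerys_theorem[THEN conjunct2, THEN conjunct2])
    show "(\<lambda>n. mollifier n k * g k) \<longlonglongrightarrow> g k" for k
      using tendsto_mult_right[OF mollifier_tendsto, of k "g k"] by simp
    show "\<forall>\<^sub>F (k, n) in at_top \<times>\<^sub>F sequentially. norm (mollifier n k * g k) \<le> g k"
      using mollifier_bounds assms(2)
      by (intro always_eventually) (auto simp: abs_mult intro: mult_left_le_one_le)
  qed (use assms in auto)
  ultimately show ?thesis by presburger
qed

theorem theorem1p1:
  fixes r :: nat and a :: "nat \<Rightarrow> nat"
  assumes "r \<ge> 1" and "a 1 \<ge> 1"
  shows "mzsv (concat (map (\<lambda>i. replicate (a i) 2 @ [1]) [1..<r+1])) =
    (\<Sum>cs | length cs = r - 1.
       let p = join_seps (map (\<lambda>i. 2 * a i + 1) [1..<r+1]) cs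
       in 2 ^ length p * mzv p)"
proof -
  let ?xs = "map (\<lambda>i. 2 * a i + 1) [1..<r+1]" and ?S = "{cs :: sep list. length cs = r - 1}"
  \<comment> \<open>The bound 3 is \<open>2 * a 1 + 1\<close> with \<open>a 1 \<ge> 1\<close>;
    joining can only enlarge the first entry, so it passes to every index \<open>p\<close>.\<close>
  have xs: "?xs \<noteq> []" "0 \<notin> set ?xs" "hd ?xs \<ge> 3"
    using assms by (auto simp: hd_map simp del: upt_Suc)
  have p: "join_seps ?xs cs \<noteq> []" "0 \<notin> set (join_seps ?xs cs)" "hd (join_seps ?xs cs) \<ge> 3" for cs
    using xs(1) join_seps_pos[OF xs(2)] order_trans[OF xs(3) hd_join_seps]
    by (simp_all only: join_seps_Nil_iff not_False_eq_True)
  have W: "two_one_weight ?xs = (\<lambda>k. \<Sum>cs\<in>?S. 2 ^ length (join_seps ?xs cs) * mhs_term (join_seps ?xs cs) k)"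
    by (rule ext, subst two_one_weight_eq_sum[OF xs(1,2)]) simp
  have summ: "summable (\<lambda>k. 2 ^ length (join_seps ?xs cs) * mhs_term (join_seps ?xs cs) k)" for cs
    by (intro summable_mult mhs_term_summable p)
  have "mhs_star (concat (map (\<lambda>i. replicate (a i) 2 @ [1]) [1..<r+1])) = mollified (two_one_weight ?xs)"
    using mhs_star_two_one[of "map a [1..<r+1]"] by (simp add: o_def del: upt_Suc)
  moreover have "mollified (two_one_weight ?xs) \<longlonglongrightarrow> suminf (two_one_weight ?xs)"
    unfolding W by (intro mollified_tendsto summable_sum summ sum_nonneg mult_nonneg_nonneg mhs_term_nonneg) auto
  ultimately have "mzsv (concat (map (\<lambda>i. replicate (a i) 2 @ [1]) [1..<r+1])) = suminf (two_one_weight ?xs)"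
    by (simp add: mzsv_def limI del: upt_Suc)
  also have "\<dots> = (\<Sum>cs\<in>?S. 2 ^ length (join_seps ?xs cs) * mzv (join_seps ?xs cs))"
    unfolding W by (subst suminf_sum[OF summ])
      (simp only: suminf_mult[OF mhs_term_summable[OF p]] mzv_eq_suminf[OF p])
  finally show ?thesis by (simp only: Let_def)
qed

end
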